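(* Let $g,q,z_d\in\mathbb{R}$, $M_3>0$ and $\alpha>0$. Let $b_{\alpha_{op}}$ be the minimizer of $J_{3\alpha}$ over $\mathbb{R}$ and, for $h=x_0/n$ with $n\ge1$ an integer, let $b^h_{\alpha_{op}}$ be the minimizer of $J^h_{3\alpha}$ over $\mathbb{R}$. (a) $$b^h_{\alpha_{op}}=b_{\alpha_{op}}+E_1gx_0h\left(1+\frac4{\alpha x_0}+\frac h{3x_0}\right),\qquad E_1=\frac1{4\left(1+\frac{M_3}{x_0}\right)}.$$ (b) There are constants $C_{13\alpha},C_{14\alpha}$ not depending on $h$ such that, as $h\to0$ ($h=x_0/n$, $n\to\infty$), $$|b^h_{\alpha_{op}}-b_{\alpha_{op}}|=C_{13\alpha}h+o(h),\qquad|J^h_{3\alpha}(b^h_{\alpha_{op}})-J_{3\alpha}(b_{\alpha_{op}})|=C_{14\alpha}h+o(h).$$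
   Context: Fix $x_0,y_0>0$, $\Omega=(0,x_0)\times(0,y_0)$, $\Gamma_1=\{0\}\times(0,y_0]$, $H=L^2(\Omega)$ with its standard norm, $B=H^{1/2}(\Gamma_1)$. For constants $g,q,b\in\mathbb{R}$ and $\alpha>0$, the system $-\Delta u=g$ in $\Omega$, $-\partial u/\partial n=\alpha(u-b)$ on $\Gamma_1$, $-\partial u/\partial n=q$ on $\{x_0\}\times(0,y_0]$, $-\partial u/\partial n=0$ on $[0,x_0]\times\{0,y_0\}$ has solution $u_{\alpha b}(x,y)=-\tfrac12gx^2+(gx_0-q)x+\tfrac1\alpha(gx_0-q)+b$. For an integer $n\ge1$, $h=x_0/n$, $x_i=(i-1)h$, its discrete (finite-difference, piecewise linear) approximation is $u^h_{\alpha b}(x,y)=(gx_0-q-hgi)x+b+\tfrac{gx_0-q}\alpha-\tfrac{gh}\alpha+\tfrac{i^2-i}2gh^2$ for $x\in[x_i,x_{i+1}]$, $y\in[0,y_0]$, $i=1,\dots,n$. For fixed $g,q,z_d\in\mathbb{R}$ and $M_3>0$ the cost functions on $\mathbb{R}$ are $J_{3\alpha}(b)=\tfrac12\|u_{\alpha b}-z_d\|_H^2+\tfrac{M_3}2\|b\|_B^2$ and $J^h_{3\alpha}(b)=\tfrac12\|u^h_{\alpha b}-z_d\|_H^2+\tfrac{M_3}2\|b\|_B^2$, where $\|b\|_B^2=y_0b^2$ for constant $b$. The minimizer of $J_{3\alpha}$ is $b_{\alpha_{op}}=\left(-\tfrac{gx_0^2}3+\tfrac{qx_0}2+z_d-\tfrac{gx_0-q}\alpha\right)\Big/\left(1+\tfrac{M_3}{x_0}\right)$.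 *)

theory Defs
  imports "HOL-Analysis.Analysis" "HOL-Library.Landau_Symbols"
begin

definition Omega :: "real \<Rightarrow> real \<Rightarrow> (real \<times> real) set" where
  "Omega x0 y0 = {0<..<x0} \<times> {0<..<y0}"

definition norm_H :: "real \<Rightarrow> real \<Rightarrow> (real \<times> real \<Rightarrow> real) \<Rightarrow> real" where
  "norm_H x0 y0 f = sqrt (LINT p:Omega x0 y0|lborel. (f p)\<^sup>2)"

text \<open>
  The Sobolev--Slobodeckij norm of \<open>H\<^sup>1\<^sup>/\<^sup>2\<close> on the segment \<open>{0} \<times> (0, y0]\<close>, which is
  parametrised by its arc length \<open>y\<close>. On a constant \<open>b\<close> the double integral vanishes and the
  square of the norm is \<open>y0 * b\<^sup>2\<close>.
\<close>

definition norm_B :: "real \<Rightarrow> (real \<times> real \<Rightarrow> real) \<Rightarrow> real" where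
  "norm_B y0 f =
     sqrt ((LINT y:{0<..y0}|lborel. (f (0, y))\<^sup>2) +
           (LINT p:{0<..y0} \<times> {0<..y0}|lborel.
              (f (0, fst p) - f (0, snd p))\<^sup>2 / (fst p - snd p)\<^sup>2))"

lemma norm_B_const:
  assumes "y0 > 0"
  shows "(norm_B y0 (\<lambda>_. b))\<^sup>2 = y0 * b\<^sup>2"
  using assms by (simp add: norm_B_def set_lebesgue_integral_def)

text \<open>
  Classical form of the system: the outward normal derivative is minus the one-sided derivative in
  \<open>x\<close> on the left side, plus that derivative on the right side, and similarly in \<open>y\<close> on the
  horizontal sides.
\<close>

definition solves_system ::
    "real \<Rightarrow> real \<Rightarrow> real \<Rightarrow> real \<Rightarrow> real \<Rightarrow> real \<Rightarrow> (real \<times> real \<Rightarrow> real) \<Rightarrow> bool" where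
  "solves_system x0 y0 g q \<alpha> b u \<longleftrightarrow>
     (\<exists>ux uy uxx uyy :: real \<times> real \<Rightarrow> real.
        (\<forall>x\<in>{0<..<x0}. \<forall>y\<in>{0<..<y0}.
           ((\<lambda>s. u (s, y)) has_real_derivative ux (x, y)) (at x) \<and>
           ((\<lambda>t. u (x, t)) has_real_derivative uy (x, y)) (at y) \<and>
           ((\<lambda>s. ux (s, y)) has_real_derivative uxx (x, y)) (at x) \<and>
           ((\<lambda>t. uy (x, t)) has_real_derivative uyy (x, y)) (at y) \<and>
           - (uxx (x, y) + uyy (x, y)) = g)) \<and>
     (\<forall>y\<in>{0<..y0}.
        ((\<lambda>s. u (s, y)) has_real_derivative \<alpha> * (u (0, y) - b)) (at 0 within {0..x0}) \<and>
        ((\<lambda>s. u (s, y)) has_real_derivative - q) (at x0 within {0..x0})) \<and>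
     (\<forall>x\<in>{0..x0}. \<forall>y\<in>{0, y0}.
        ((\<lambda>t. u (x, t)) has_real_derivative 0) (at y within {0..y0}))"

definition u_state :: "real \<Rightarrow> real \<Rightarrow> real \<Rightarrow> real \<Rightarrow> real \<Rightarrow> real \<times> real \<Rightarrow> real" where
  "u_state x0 g q \<alpha> b = (\<lambda>(x, y).
     - (1 / 2) * g * x\<^sup>2 + (g * x0 - q) * x + 1 / \<alpha> * (g * x0 - q) + b)"

lemma u_state_solves_system:
  assumes "\<alpha> > 0"
  shows "solves_system x0 y0 g q \<alpha> b (u_state x0 g q \<alpha> b)"
  unfolding solves_system_def
proof (intro conjI)
  show "\<exists>ux uy uxx uyy :: real \<times> real \<Rightarrow> real.
        (\<forall>x\<in>{0<..<x0}. \<forall>y\<in>{0<..<y0}.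
           ((\<lambda>s. u_state x0 g q \<alpha> b (s, y)) has_real_derivative ux (x, y)) (at x) \<and>
           ((\<lambda>t. u_state x0 g q \<alpha> b (x, t)) has_real_derivative uy (x, y)) (at y) \<and>
           ((\<lambda>s. ux (s, y)) has_real_derivative uxx (x, y)) (at x) \<and>
           ((\<lambda>t. uy (x, t)) has_real_derivative uyy (x, y)) (at y) \<and>
           - (uxx (x, y) + uyy (x, y)) = g)"
    by (rule exI[of _ "\<lambda>p. - g * fst p + (g * x0 - q)"], rule exI[of _ "\<lambda>_. 0"],
        rule exI[of _ "\<lambda>_. - g"], rule exI[of _ "\<lambda>_. 0"])
       (auto simp: u_state_def intro!: derivative_eq_intros)
qed (use assms in \<open>auto simp: u_state_def field_simps intro!: derivative_eq_intros\<close>)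

definition mesh :: "real \<Rightarrow> nat \<Rightarrow> real" where
  "mesh x0 n = x0 / real n"

definition node :: "real \<Rightarrow> nat \<Rightarrow> nat \<Rightarrow> real" where
  "node x0 n i = (real i - 1) * mesh x0 n"

definition cell :: "real \<Rightarrow> nat \<Rightarrow> real \<Rightarrow> nat" where
  "cell x0 n x = min n (nat \<lfloor>x / mesh x0 n\<rfloor> + 1)"

definition uh_state :: "real \<Rightarrow> real \<Rightarrow> real \<Rightarrow> real \<Rightarrow> nat \<Rightarrow> real \<Rightarrow> real \<times> real \<Rightarrow> real" where
  "uh_state x0 g q \<alpha> n b = (\<lambda>(x, y).
     let h = mesh x0 n; i = real (cell x0 n x)
     in (g * x0 - q - h * g * i) * x + b + (g * x0 - q) / \<alpha> - g * h / \<alpha>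
        + (i\<^sup>2 - i) / 2 * g * h\<^sup>2)"

text \<open>
  The affine pieces agree at the common endpoint of adjacent cells, so the formula holds on every
  closed cell, independently of which cell \<open>cell\<close> assigns to a node.
\<close>

lemma uh_state_on_cell:
  assumes "x0 > 0" "1 \<le> i" "i \<le> n" "x \<in> {node x0 n i..node x0 n (i + 1)}"
  defines "h \<equiv> mesh x0 n"
  shows "uh_state x0 g q \<alpha> n b (x, y) =
    (g * x0 - q - h * g * real i) * x + b + (g * x0 - q) / \<alpha> - g * h / \<alpha>
      + ((real i)\<^sup>2 - real i) / 2 * g * h\<^sup>2"
proof -
  have h: "h > 0" using assms by (simp add: h_def mesh_def)
  have lo: "(real i - 1) * h \<le> x" and hi: "x \<le> real i * h"
    using assms by (simp_all add: node_def)
  show ?thesis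
  proof (cases "x = real i * h")
    case False
    with hi have "x < real i * h" by simp
    with lo h have "real i - 1 \<le> x / h" "x / h < real i"
      by (simp_all add: field_simps)
    then have "\<lfloor>x / h\<rfloor> = int i - 1" by (simp add: floor_eq_iff)
    then have "cell x0 n x = i" using assms by (simp add: cell_def)
    then show ?thesis by (simp add: uh_state_def Let_def h_def)
  next
    case True
    then have "x / h = real i" using h by simp
    then have c: "cell x0 n x = min n (i + 1)" by (simp add: cell_def h_def)
    show ?thesis
    proof (cases "i = n")
      case True
      with c show ?thesis by (simp add: uh_state_def Let_def h_def)
    next
      case False
      with c assms have "cell x0 n x = i + 1" by simp
      with True show ?thesis
        by (simp add: uh_state_def Let_def h_def[symmetric] field_simps power2_eq_square)
    qed
  qed
qed

definition J3 ::
    "real \<Rightarrow> real \<Rightarrow> real \<Rightarrow> real \<Rightarrow> real \<Rightarrow> real \<Rightarrow> real \<Rightarrow> real \<Rightarrow> real" where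
  "J3 x0 y0 g q zd M3 \<alpha> b =
     1 / 2 * (norm_H x0 y0 (\<lambda>p. u_state x0 g q \<alpha> b p - zd))\<^sup>2
     + M3 / 2 * (norm_B y0 (\<lambda>_. b))\<^sup>2"

definition J3h ::
    "real \<Rightarrow> real \<Rightarrow> real \<Rightarrow> real \<Rightarrow> real \<Rightarrow> real \<Rightarrow> real \<Rightarrow> nat \<Rightarrow> real \<Rightarrow> real" where
  "J3h x0 y0 g q zd M3 \<alpha> n b =
     1 / 2 * (norm_H x0 y0 (\<lambda>p. uh_state x0 g q \<alpha> n b p - zd))\<^sup>2
     + M3 / 2 * (norm_B y0 (\<lambda>_. b))\<^sup>2"

text \<open>The cost functions do attain their minimum, exactly once.\<close>

lemma quadratic_cost_ex1_min:
  fixes w :: "real \<times> real \<Rightarrow> real"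
  assumes pos: "x0 > 0" "y0 > 0" "M3 > 0"
    and w: "w \<in> borel_measurable borel" and K: "\<And>p. p \<in> Omega x0 y0 \<Longrightarrow> \<bar>w p\<bar> \<le> K"
    and J: "\<And>b. J b = 1 / 2 * (norm_H x0 y0 (\<lambda>p. w p + b))\<^sup>2 + M3 / 2 * (norm_B y0 (\<lambda>_. b))\<^sup>2"
  shows "\<exists>!b. is_arg_min J (\<lambda>_. True) b"
proof -
  let ?S = "Omega x0 y0"
  have box: "?S = box (0, 0) (x0, y0)"
    by (auto simp: Omega_def box_def Basis_prod_def)
  have meas: "?S \<in> sets lborel" unfolding box by simp
  have fin: "emeasure lborel ?S < \<infinity>"
    unfolding box using emeasure_lborel_box_finite by (simp add: less_top)
  define V where "V = measure lborel ?S"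
  have V: "V \<ge> 0" by (simp add: V_def)
  have int_w: "set_integrable lborel ?S w"
    unfolding set_integrable_def
    by (rule integrableI_bounded_set_indicator[OF meas _ fin, where B = K]) (use w K in auto)
  have w2: "(\<lambda>p. (w p)\<^sup>2) \<in> borel_measurable borel" using w by simp
  have K2: "(w p)\<^sup>2 \<le> K\<^sup>2" if "p \<in> ?S" for p
    using power_mono[OF K[OF that] abs_ge_zero, of 2] by simp
  have int_w2: "set_integrable lborel ?S (\<lambda>p. (w p)\<^sup>2)"
    unfolding set_integrable_def
    by (rule integrableI_bounded_set_indicator[OF meas _ fin, where B = "K\<^sup>2"])
       (use w2 K2 in auto)
  define A where "A = (LINT p:?S|lborel. (w p)\<^sup>2)"
  define I where "I = (LINT p:?S|lborel. w p)"
  have eq: "(norm_H x0 y0 (\<lambda>p. w p + b))\<^sup>2 = A + 2 * b * I + b\<^sup>2 * V" for b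
  proof -
    have c: "set_integrable lborel ?S (\<lambda>_. b\<^sup>2)"
      unfolding set_integrable_def using meas fin by simp
    have "(norm_H x0 y0 (\<lambda>p. w p + b))\<^sup>2 = (LINT p:?S|lborel. (w p + b)\<^sup>2)"
      unfolding norm_H_def set_lebesgue_integral_def by (simp add: integral_nonneg_AE)
    also have "\<dots> = (LINT p:?S|lborel. (w p)\<^sup>2 + (2 * b) * w p + b\<^sup>2)"
      by (simp add: power2_sum algebra_simps)
    also have "\<dots> = (LINT p:?S|lborel. (w p)\<^sup>2) + (LINT p:?S|lborel. (2 * b) * w p)
        + (LINT p:?S|lborel. b\<^sup>2)"
      using int_w int_w2 c by (simp add: set_integral_add)
    also have "\<dots> = A + 2 * b * I + b\<^sup>2 * V"
      unfolding A_def I_def V_def by (simp add: set_lebesgue_integral_def mult.assoc)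
    finally show ?thesis .
  qed
  define a where "a = V / 2 + M3 / 2 * y0"
  have a: "a > 0" using V pos by (simp add: a_def add_nonneg_pos)
  define m where "m = - I / (2 * a)"
  have I: "I = - 2 * a * m" using a by (simp add: m_def)
  have Jb: "J b = A / 2 + b * I + b\<^sup>2 * a" for b
    unfolding J eq norm_B_const[OF pos(2)] a_def by (simp add: field_simps)
  have Jm: "J b = J m + a * (b - m)\<^sup>2" for b
    unfolding Jb I by (simp add: power2_eq_square algebra_simps)
  show ?thesis
  proof (rule ex1I[of _ m])
    show "is_arg_min J (\<lambda>_. True) m"
      unfolding is_arg_min_def
      using a Jm by (metis add_increasing2 linorder_not_less mult_nonneg_nonneg order.strict_implies_order
          order_refl zero_le_power2)
  next
    fix b assume "is_arg_min J (\<lambda>_. True) b"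
    then have "\<not> J m < J b" by (simp add: is_arg_min_def)
    with Jm[of b] have "a * (b - m)\<^sup>2 \<le> 0" by simp
    with a show "b = m"
      by (metis eq_iff_diff_eq_0 mult_le_0_iff not_less power2_less_eq_zero_iff)
  qed
qed

lemma J3_ex1_min:
  assumes "x0 > 0" "y0 > 0" "M3 > 0"
  shows "\<exists>!b. is_arg_min (J3 x0 y0 g q zd M3 \<alpha>) (\<lambda>_. True) b"
proof (rule quadratic_cost_ex1_min[OF assms])
  let ?w = "\<lambda>p. u_state x0 g q \<alpha> 0 p - zd"
  have [measurable]: "(fst :: real \<times> real \<Rightarrow> real) \<in> borel_measurable borel"
    by (intro borel_measurable_continuous_onI continuous_intros)
  show "?w \<in> borel_measurable borel"
    unfolding u_state_def case_prod_beta by measurable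
  show "\<bar>?w p\<bar> \<le> \<bar>g\<bar> * x0\<^sup>2 + \<bar>g * x0 - q\<bar> * x0 + \<bar>1 / \<alpha> * (g * x0 - q)\<bar> + \<bar>zd\<bar>"
    if "p \<in> Omega x0 y0" for p
  proof -
    have x: "0 \<le> fst p" "fst p \<le> x0" using that by (auto simp: Omega_def)
    have 1: "\<bar>1 / 2 * g * (fst p)\<^sup>2\<bar> \<le> \<bar>g\<bar> * x0\<^sup>2"
      unfolding abs_mult by (intro mult_mono) (use x in \<open>auto intro: power_mono\<close>)
    have 2: "\<bar>(g * x0 - q) * fst p\<bar> \<le> \<bar>g * x0 - q\<bar> * x0"
      unfolding abs_mult by (intro mult_mono) (use x in auto)
    show ?thesis using 1 2 unfolding u_state_def case_prod_beta by linarith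
  qed
  show "J3 x0 y0 g q zd M3 \<alpha> b =
      1 / 2 * (norm_H x0 y0 (\<lambda>p. ?w p + b))\<^sup>2 + M3 / 2 * (norm_B y0 (\<lambda>_. b))\<^sup>2" for b
    by (simp add: J3_def u_state_def case_prod_beta algebra_simps)
qed

lemma J3h_ex1_min:
  assumes "x0 > 0" "y0 > 0" "M3 > 0"
  shows "\<exists>!b. is_arg_min (J3h x0 y0 g q zd M3 \<alpha> n) (\<lambda>_. True) b"
proof (rule quadratic_cost_ex1_min[OF assms])
  let ?w = "\<lambda>p. uh_state x0 g q \<alpha> n 0 p - zd"
  define h where "h = mesh x0 n"
  have [measurable]: "(fst :: real \<times> real \<Rightarrow> real) \<in> borel_measurable borel"
    by (intro borel_measurable_continuous_onI continuous_intros)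
  show "?w \<in> borel_measurable borel"
    unfolding uh_state_def case_prod_beta Let_def cell_def by measurable
  show "\<bar>?w p\<bar> \<le> (\<bar>g * x0 - q\<bar> + \<bar>h * g\<bar> * real n) * x0 + \<bar>(g * x0 - q) / \<alpha>\<bar> + \<bar>g * h / \<alpha>\<bar>
      + (real n)\<^sup>2 * \<bar>g * h\<^sup>2\<bar> + \<bar>zd\<bar>"
    if "p \<in> Omega x0 y0" for p
  proof -
    have x: "0 \<le> fst p" "fst p \<le> x0" using that by (auto simp: Omega_def)
    define i where "i = cell x0 n (fst p)"
    have i: "i \<le> n" by (simp add: i_def cell_def)
    have ii: "real i \<le> (real i)\<^sup>2"
      by (cases "i = 0") (auto simp: power2_eq_square)
    have "\<bar>g * x0 - q - h * g * real i\<bar> \<le> \<bar>g * x0 - q\<bar> + \<bar>h * g * real i\<bar>"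
      by linarith
    also have "\<bar>h * g * real i\<bar> \<le> \<bar>h * g\<bar> * real n"
      unfolding abs_mult by (intro mult_mono) (use i in auto)
    finally have "\<bar>g * x0 - q - h * g * real i\<bar> \<le> \<bar>g * x0 - q\<bar> + \<bar>h * g\<bar> * real n" by simp
    then have 1: "\<bar>(g * x0 - q - h * g * real i) * fst p\<bar>
        \<le> (\<bar>g * x0 - q\<bar> + \<bar>h * g\<bar> * real n) * x0"
      unfolding abs_mult[of _ "fst p"] by (intro mult_mono) (use x in auto)
    have "\<bar>(a - r) / 2\<bar> \<le> a" if "0 \<le> r" "r \<le> a" for a r :: real
      using that by (simp add: abs_if)
    from this[OF _ ii] have "\<bar>((real i)\<^sup>2 - real i) / 2\<bar> \<le> (real i)\<^sup>2" by simp
    also have "\<dots> \<le> (real n)\<^sup>2" using i by (intro power_mono) auto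
    finally have "\<bar>((real i)\<^sup>2 - real i) / 2 * (g * h\<^sup>2)\<bar> \<le> (real n)\<^sup>2 * \<bar>g * h\<^sup>2\<bar>"
      unfolding abs_mult[of _ "g * h\<^sup>2"] by (intro mult_right_mono) auto
    then have 2: "\<bar>((real i)\<^sup>2 - real i) / 2 * g * h\<^sup>2\<bar> \<le> (real n)\<^sup>2 * \<bar>g * h\<^sup>2\<bar>"
      by (simp add: mult.assoc)
    have add: "\<bar>a + b\<bar> \<le> c + d" and diff: "\<bar>a - b\<bar> \<le> c + d"
      if "\<bar>a\<bar> \<le> c" "\<bar>b\<bar> \<le> d" for a b c d :: real
      using that by linarith+
    show ?thesis
      unfolding uh_state_def case_prod_beta Let_def h_def[symmetric] i_def[symmetric] add_0_right
      by (intro diff add 1 2 order_refl)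
  qed
  show "J3h x0 y0 g q zd M3 \<alpha> n b =
      1 / 2 * (norm_H x0 y0 (\<lambda>p. ?w p + b))\<^sup>2 + M3 / 2 * (norm_B y0 (\<lambda>_. b))\<^sup>2" for b
    by (simp add: J3h_def uh_state_def Let_def case_prod_beta algebra_simps)
qed

end

theory Submission
  imports Defs
begin

text \<open>
  Both states depend on \<open>b\<close> only by adding \<open>b\<close>, so with \<open>w = u\<^bsub>\<alpha>0\<^esub> - z\<^sub>d\<close> (respectively its
  discrete counterpart \<open>v\<close>) the cost is a quadratic polynomial in \<open>b\<close>. Completing the square
  gives the minimizer \<open>- I / c\<close> and the minimum \<open>A / 2 - I\<^sup>2 / (2 * c)\<close>, where \<open>I\<close> and \<open>A\<close> are
  the integrals of \<open>w\<close> and \<open>w\<^sup>2\<close> over the rectangle and \<open>c = y0 * (x0 + M3)\<close>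
  (\<open>quadratic_cost_minimum\<close>). Everything therefore reduces to comparing \<open>I\<close> and \<open>A\<close> for the two
  states.

  On the cell \<open>[x\<^sub>i, x\<^sub>i + h]\<close> the discrete state is the exact one minus
  \<open>h * g * (1 / \<alpha> + x / 2)\<close> and minus the bump \<open>g / 2 * (x - x\<^sub>i) * (x\<^sub>i + h - x)\<close>, which is the
  interpolation error of a parabola (\<open>uh_state_eq_u_state_on_cell\<close>). Each bump has mean
  \<open>g * h\<^sup>2 / 12\<close>, so \<open>I\<close> changes by an explicit quadratic polynomial in \<open>h\<close> without constant term
  (\<open>has_integral_state_difference\<close>); this is the formula for the minimizer.
  For \<open>A\<close> and the minimum, the first-order term suffices: the bump is \<open>O(h\<^sup>2)\<close> uniformly, hence
  \<open>A\<close> changes by a multiple of \<open>h\<close> up to \<open>O(h\<^sup>2)\<close> (\<open>set_integral_square_expansion\<close>).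
  Finally, \<open>C * h + O(h\<^sup>2)\<close> has absolute value \<open>\<bar>C\<bar> * h + o(h)\<close> whatever the sign of \<open>C\<close>
  (\<open>abs_first_order_smallo\<close>).
\<close>

section \<open>Integration over the rectangle\<close>

lemma measure_Omega:
  assumes "x0 \<ge> 0" "y0 \<ge> 0"
  shows "measure lborel (Omega x0 y0) = x0 * y0"
proof -
  have "emeasure lborel (Omega x0 y0) = ennreal (x0 * y0)"
    unfolding Omega_def lborel_prod[symmetric]
    using assms by (simp add: lborel.emeasure_pair_measure_Times ennreal_mult)
  then show ?thesis using assms by (simp add: measure_def)
qed

lemma Omega_finite_measure:
  "Omega x0 y0 \<in> sets lborel" "emeasure lborel (Omega x0 y0) < \<infinity>"
proof -
  have box: "Omega x0 y0 = box (0, 0) (x0, y0)"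
    by (auto simp: Omega_def box_def Basis_prod_def)
  show "Omega x0 y0 \<in> sets lborel" unfolding box by simp
  show "emeasure lborel (Omega x0 y0) < \<infinity>"
    unfolding box using emeasure_lborel_box_finite by (simp add: less_top)
qed

lemma set_integrable_Omega_bounded:
  fixes f :: "real \<times> real \<Rightarrow> real"
  assumes "f \<in> borel_measurable borel" "\<And>p. p \<in> Omega x0 y0 \<Longrightarrow> \<bar>f p\<bar> \<le> K"
  shows "set_integrable lborel (Omega x0 y0) f"
  unfolding set_integrable_def
  by (rule integrableI_bounded_set_indicator[OF Omega_finite_measure(1) _ Omega_finite_measure(2),
        where B = K]) (use assms in auto)

lemma abs_set_integral_Omega_le:
  fixes f :: "real \<times> real \<Rightarrow> real"
  assumes "x0 \<ge> 0" "y0 \<ge> 0" and f: "f \<in> borel_measurable borel"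
    and K: "\<And>p. p \<in> Omega x0 y0 \<Longrightarrow> \<bar>f p\<bar> \<le> K"
  shows "\<bar>LINT p:Omega x0 y0|lborel. f p\<bar> \<le> K * (x0 * y0)"
proof -
  let ?S = "Omega x0 y0"
  have int: "set_integrable lborel ?S f" using f K by (rule set_integrable_Omega_bounded)
  have c: "set_integrable lborel ?S (\<lambda>_. c :: real)" for c
    by (rule set_integrable_Omega_bounded[where K = "\<bar>c\<bar>"]) auto
  have v: "(LINT p:?S|lborel. c) = c * (x0 * y0)" for c :: real
    using Omega_finite_measure[of x0 y0] measure_Omega[OF assms(1,2)]
    by (simp add: set_lebesgue_integral_def)
  have "(LINT p:?S|lborel. f p) \<le> (LINT p:?S|lborel. K)"
    using K by (intro set_integral_mono int c) (auto simp: abs_le_iff)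
  moreover have "(LINT p:?S|lborel. - K) \<le> (LINT p:?S|lborel. f p)"
  proof (intro set_integral_mono int c)
    fix p assume "p \<in> ?S" from K[OF this] show "- K \<le> f p" by linarith
  qed
  ultimately show ?thesis unfolding v by simp
qed

text \<open>
  The states do not depend on \<open>y\<close>, so Fubini reduces their integrals to one variable. The
  result is a gauge integral because the fundamental theorem of calculus will be applied to it cell
  by cell.
\<close>

lemma set_integral_Omega_fst:
  fixes f :: "real \<Rightarrow> real"
  assumes pos: "x0 \<ge> 0" "y0 \<ge> 0"
    and f: "f \<in> borel_measurable borel" and K: "\<And>x. x \<in> {0<..<x0} \<Longrightarrow> \<bar>f x\<bar> \<le> K"
  shows "(LINT p:Omega x0 y0|lborel. f (fst p)) = y0 * integral {0..x0} f"
proof -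
  let ?g = "\<lambda>(x, y). (indicat_real {0<..<x0} x * f x) * indicat_real {0<..<y0} y"
  have [measurable]: "(fst :: real \<times> real \<Rightarrow> real) \<in> borel_measurable borel"
    by (intro borel_measurable_continuous_onI continuous_intros)
  have mf: "(\<lambda>p. f (fst p)) \<in> borel_measurable (borel :: (real \<times> real) measure)"
    using f by measurable
  have g: "indicat_real (Omega x0 y0) p *\<^sub>R f (fst p) = ?g p" for p
    by (cases p) (simp add: Omega_def indicator_def)
  have "set_integrable lborel (Omega x0 y0) (\<lambda>p. f (fst p))"
    by (rule set_integrable_Omega_bounded[OF mf, where K = K]) (use K in \<open>auto simp: Omega_def\<close>)
  then have int: "integrable (lborel \<Otimes>\<^sub>M lborel) ?g"
    unfolding set_integrable_def g lborel_prod .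
  have "(LINT p:Omega x0 y0|lborel. f (fst p)) = (\<integral>p. ?g p \<partial>(lborel \<Otimes>\<^sub>M lborel))"
    unfolding set_lebesgue_integral_def g lborel_prod ..
  also have "\<dots> = (\<integral>x. (\<integral>y. ?g (x, y) \<partial>lborel) \<partial>lborel)"
    by (rule lborel_pair.integral_fst'[OF int, symmetric])
  also have "\<dots> = y0 * (LINT x:{0<..<x0}|lborel. f x)"
    using pos by (simp add: set_lebesgue_integral_def mult.commute)
  also have "(LINT x:{0<..<x0}|lborel. f x) = integral {0<..<x0} f"
  proof (rule set_borel_integral_eq_integral)
    show "set_integrable lborel {0<..<x0} f"
      unfolding set_integrable_def
      by (rule integrableI_bounded_set_indicator[where B = K]) (use f K pos in auto)
  qed
  also have "\<dots> = integral {0..x0} f"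
    by (simp add: integral_open_interval_real)
  finally show ?thesis .
qed

section \<open>Minimizer and minimum of the quadratic cost\<close>

text \<open>
  In terms of \<open>b\<close> the cost is \<open>A / 2 + b * I + c * b\<^sup>2 / 2\<close>, because the rectangle has area
  \<open>x0 * y0\<close> and the penalty contributes \<open>M3 * y0 * b\<^sup>2 / 2\<close>.
\<close>

lemma quadratic_cost_minimum:
  fixes w :: "real \<times> real \<Rightarrow> real"
  assumes pos: "x0 > 0" "y0 > 0" "M3 > 0"
    and w: "w \<in> borel_measurable borel" and K: "\<And>p. p \<in> Omega x0 y0 \<Longrightarrow> \<bar>w p\<bar> \<le> K"
    and J: "\<And>b. J b = 1 / 2 * (norm_H x0 y0 (\<lambda>p. w p + b))\<^sup>2 + M3 / 2 * (norm_B y0 (\<lambda>_. b))\<^sup>2"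
    and m: "is_arg_min J (\<lambda>_. True) m"
  defines "I \<equiv> LINT p:Omega x0 y0|lborel. w p"
    and "A \<equiv> LINT p:Omega x0 y0|lborel. (w p)\<^sup>2"
    and "c \<equiv> y0 * (x0 + M3)"
  shows "m = - I / c" "J m = A / 2 - I\<^sup>2 / (2 * c)"
proof -
  let ?S = "Omega x0 y0"
  have int_w: "set_integrable lborel ?S w" using w K by (rule set_integrable_Omega_bounded)
  have K2: "\<bar>(w p)\<^sup>2\<bar> \<le> K\<^sup>2" if "p \<in> ?S" for p
    using power_mono[OF K[OF that] abs_ge_zero, of 2] by simp
  have int_w2: "set_integrable lborel ?S (\<lambda>p. (w p)\<^sup>2)"
    by (rule set_integrable_Omega_bounded[OF _ K2]) (use w in auto)
  have int_c: "set_integrable lborel ?S (\<lambda>_. b\<^sup>2)" for b :: real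
    by (rule set_integrable_Omega_bounded[where K = "b\<^sup>2"]) auto
  have norm: "(norm_H x0 y0 (\<lambda>p. w p + b))\<^sup>2 = A + 2 * b * I + b\<^sup>2 * (x0 * y0)" for b
  proof -
    have "(norm_H x0 y0 (\<lambda>p. w p + b))\<^sup>2 = (LINT p:?S|lborel. (w p + b)\<^sup>2)"
      unfolding norm_H_def set_lebesgue_integral_def by (simp add: integral_nonneg_AE)
    also have "\<dots> = (LINT p:?S|lborel. (w p)\<^sup>2 + (2 * b) * w p + b\<^sup>2)"
      by (simp add: power2_sum algebra_simps)
    also have "\<dots> = (LINT p:?S|lborel. (w p)\<^sup>2) + (LINT p:?S|lborel. (2 * b) * w p)
        + (LINT p:?S|lborel. b\<^sup>2)"
      using int_w int_w2 int_c by (simp add: set_integral_add)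
    also have "\<dots> = A + 2 * b * I + b\<^sup>2 * (x0 * y0)"
      using pos measure_Omega[of x0 y0] unfolding A_def I_def
      by (simp add: set_lebesgue_integral_def mult.assoc)
    finally show ?thesis .
  qed
  have c: "c > 0" using pos by (simp add: c_def)
  have Jb: "J b = A / 2 - I\<^sup>2 / (2 * c) + c / 2 * (b + I / c)\<^sup>2" for b
  proof -
    have "J b = A / 2 + b * I + b\<^sup>2 * c / 2"
      unfolding J norm norm_B_const[OF pos(2)] c_def by (simp add: field_simps)
    also have "\<dots> = A / 2 - I\<^sup>2 / (2 * c) + c / 2 * (b + I / c)\<^sup>2"
      using c by (simp add: field_simps power2_eq_square)
    finally show ?thesis .
  qed
  have "J m \<le> J (- I / c)" using m by (auto simp: is_arg_min_def not_less)
  then have "c / 2 * (m + I / c)\<^sup>2 \<le> 0" unfolding Jb by simp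
  with c have "(m + I / c)\<^sup>2 \<le> 0" by (simp add: mult_le_0_iff)
  then have z: "m + I / c = 0" by simp
  then show "m = - I / c" by simp
  show "J m = A / 2 - I\<^sup>2 / (2 * c)" unfolding Jb z by simp
qed

section \<open>Comparison of the exact and the discrete state\<close>

lemma mesh_bounds:
  assumes "x0 > 0" "n \<ge> 1"
  shows "mesh x0 n > 0" "mesh x0 n \<le> x0"
  using assms by (auto simp: mesh_def field_simps)

text \<open>
  At a node the discrete state differs from the exact one by \<open>h * g * (1 / \<alpha> + x / 2)\<close>, which is
  affine in \<open>x\<close>. Between nodes an affine function is compared with a parabola of leading
  coefficient \<open>- g / 2\<close> shifted by an affine function, which leaves the product of the distances to
  the two nodes.
\<close>

lemma uh_state_eq_u_state_on_cell:
  assumes "x0 > 0" "1 \<le> i" "i \<le> n" "x \<in> {node x0 n i..node x0 n (i + 1)}"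
  shows "uh_state x0 g q \<alpha> n b (x, y) = u_state x0 g q \<alpha> b (x, y)
    - mesh x0 n * g * (1 / \<alpha> + x / 2)
    - g / 2 * ((x - node x0 n i) * (node x0 n (i + 1) - x))"
  unfolding uh_state_on_cell[OF assms] u_state_def node_def
  by (simp add: field_simps power2_eq_square)

lemma ex_cell:
  assumes "x0 > 0" "n \<ge> 1" "x \<in> {0..x0}"
  obtains i where "1 \<le> i" "i \<le> n" "x \<in> {node x0 n i..node x0 n (i + 1)}"
proof (cases "x = x0")
  case True
  have "n * mesh x0 n = x0" using assms by (simp add: mesh_def)
  with True mesh_bounds[OF assms(1,2)] assms show ?thesis
    by (intro that[of n]) (auto simp: node_def algebra_simps)
next
  case False
  let ?h = "mesh x0 n"
  have h: "?h > 0" using mesh_bounds assms by simp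
  define j where "j = \<lfloor>x / ?h\<rfloor>"
  have j: "real_of_int j \<le> x / ?h" "x / ?h < real_of_int j + 1" unfolding j_def by linarith+
  have j0: "j \<ge> 0" using assms h by (simp add: j_def)
  have "x / ?h < n" using False assms by (simp add: mesh_def field_simps)
  with j(1) have "j < int n" by linarith
  with j0 j h show ?thesis
    by (intro that[of "nat j + 1"]) (auto simp: node_def field_simps)
qed

lemma consistency_error:
  assumes "x0 > 0" "n \<ge> 1" "x \<in> {0..x0}"
  shows "\<bar>uh_state x0 g q \<alpha> n b (x, y) - u_state x0 g q \<alpha> b (x, y)
            + mesh x0 n * g * (1 / \<alpha> + x / 2)\<bar> \<le> \<bar>g\<bar> * (mesh x0 n)\<^sup>2"
proof -
  obtain i where i: "1 \<le> i" "i \<le> n" "x \<in> {node x0 n i..node x0 n (i + 1)}"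
    using ex_cell[OF assms] .
  let ?s = "x - node x0 n i" and ?t = "node x0 n (i + 1) - x"
  have "?s + ?t = mesh x0 n" by (simp add: node_def algebra_simps)
  moreover have "?s \<ge> 0" "?t \<ge> 0" using i by auto
  ultimately have "?s * ?t \<le> mesh x0 n * mesh x0 n" "0 \<le> ?s * ?t"
    by (auto intro!: mult_mono)
  then have "\<bar>g / 2\<bar> * \<bar>?s * ?t\<bar> \<le> \<bar>g\<bar> * (mesh x0 n)\<^sup>2"
    by (intro mult_mono) (auto simp: power2_eq_square)
  then show ?thesis
    unfolding uh_state_eq_u_state_on_cell[OF assms(1) i] by (simp add: abs_mult)
qed

text \<open>
  Induction over the cells: the affine part of the difference is the same on all of them, and the
  bump of each cell contributes the same amount \<open>- g * h\<^sup>3 / 12\<close>.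
\<close>

lemma has_integral_state_difference:
  fixes k n :: nat and h x0 g q \<alpha> b y :: real
  assumes x0: "x0 > 0" and "k \<le> n"
  defines "h \<equiv> mesh x0 n"
  shows "((\<lambda>x. uh_state x0 g q \<alpha> n b (x, y) - u_state x0 g q \<alpha> b (x, y)) has_integral
      - (h * g * (k * h / \<alpha> + (k * h)\<^sup>2 / 4) + g * h\<^sup>2 / 12 * (k * h))) {0..k * h}"
  using \<open>k \<le> n\<close>
proof (induction k)
  case 0
  then show ?case by (simp add: has_integral_refl)
next
  case (Suc k)
  have h: "h > 0" using mesh_bounds x0 Suc.prems by (simp add: h_def)
  define a where "a = k * h"
  have b: "Suc k * h = a + h" by (simp add: a_def algebra_simps)
  define r where "r = 1 / \<alpha>"
  \<comment> \<open>A primitive of the formula on the cell; the bump is expanded around the left node \<open>a\<close>.\<close>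
  define F where "F = (\<lambda>x. - (h * g * (x * r + x\<^sup>2 / 4))
      - g / 2 * (h * (x - a)\<^sup>2 / 2 - (x - a) ^ 3 / 3))"
  let ?D = "\<lambda>x. uh_state x0 g q \<alpha> n b (x, y) - u_state x0 g q \<alpha> b (x, y)"
  have "(F has_real_derivative
      - (h * g * (r + x / 2)) - g / 2 * ((x - a) * (a + h - x))) (at x within {a..a + h})" for x
    unfolding F_def
    by (rule derivative_eq_intros refl | simp)+ (simp add: field_simps power2_eq_square)
  moreover have "- (h * g * (r + x / 2)) - g / 2 * ((x - a) * (a + h - x)) = ?D x"
    if "x \<in> {a..a + h}" for x
  proof -
    have nodes: "node x0 n (Suc k) = a" "node x0 n (Suc k + 1) = a + h"
      by (simp_all add: node_def a_def h_def algebra_simps)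
    from that Suc.prems show ?thesis
      by (subst uh_state_eq_u_state_on_cell[OF x0, where i = "Suc k"])
         (simp_all add: nodes[simplified] h_def[symmetric] r_def)
  qed
  ultimately have "(F has_real_derivative ?D x) (at x within {a..a + h})"
    if "x \<in> {a..a + h}" for x
    using that by metis
  then have "(?D has_integral F (a + h) - F a) {a..a + h}"
    using h by (intro fundamental_theorem_of_calculus)
      (auto simp: has_real_derivative_iff_has_vector_derivative[symmetric])
  with Suc have "(?D has_integral
      - (h * g * (a / \<alpha> + a\<^sup>2 / 4) + g * h\<^sup>2 / 12 * a) + (F (a + h) - F a)) {0..a + h}"
    using h unfolding a_def[symmetric]
    by (intro has_integral_combine[where c = a]) (auto simp: a_def)
  also have "- (h * g * (a / \<alpha> + a\<^sup>2 / 4) + g * h\<^sup>2 / 12 * a) + (F (a + h) - F a)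
      = - (h * g * ((a + h) / \<alpha> + (a + h)\<^sup>2 / 4) + g * h\<^sup>2 / 12 * (a + h))"
    by (simp add: F_def r_def field_simps power2_eq_square power3_eq_cube)
  finally show ?case unfolding b .
qed

section \<open>First-order expansions in the mesh size\<close>

lemma abs_first_order_smallo:
  assumes K: "\<And>n. n \<ge> 1 \<Longrightarrow> \<bar>e n - C * mesh x0 n\<bar> \<le> K * (mesh x0 n)\<^sup>2" and "x0 > 0"
  shows "(\<lambda>n. \<bar>e n\<bar> - \<bar>C\<bar> * mesh x0 n) \<in> o[at_top](mesh x0)"
proof -
  have "\<bar>\<bar>e n\<bar> - \<bar>C\<bar> * mesh x0 n\<bar> \<le> K * (mesh x0 n)\<^sup>2" if "n \<ge> 1" for n
    using K[OF that] mesh_bounds(1)[OF \<open>x0 > 0\<close> that]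
      abs_triangle_ineq3[of "e n" "C * mesh x0 n"] by (simp add: abs_mult)
  then have "(\<lambda>n. \<bar>e n\<bar> - \<bar>C\<bar> * mesh x0 n) \<in> O(\<lambda>n. (mesh x0 n)\<^sup>2)"
    by (intro bigoI[of _ K] eventually_sequentiallyI[of 1]) auto
  also have "(\<lambda>n. (mesh x0 n)\<^sup>2) \<in> o[at_top](mesh x0)"
  proof (rule smalloI_tendsto)
    have "mesh x0 \<longlonglongrightarrow> 0"
      unfolding mesh_def by (rule lim_const_over_n)
    moreover have "\<forall>\<^sub>F n in sequentially. mesh x0 n = (mesh x0 n)\<^sup>2 / mesh x0 n"
      by (simp add: power2_eq_square)
    ultimately show "(\<lambda>n. (mesh x0 n)\<^sup>2 / mesh x0 n) \<longlonglongrightarrow> 0"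
      using tendsto_cong by fast
    show "\<forall>\<^sub>F n in sequentially. mesh x0 n \<noteq> 0"
      using mesh_bounds(1)[OF \<open>x0 > 0\<close>] by (intro eventually_sequentiallyI[of 1]) fastforce
  qed
  finally show ?thesis .
qed

text \<open>
  With \<open>v = w + h * \<phi> + r\<close> and \<open>r = O(h\<^sup>2)\<close>, the integrand is
  \<open>w\<^sup>2 + 2 * h * w * \<phi> + (2 * w * r + (h * \<phi> + r)\<^sup>2)\<close>, where the bracket is \<open>O(h\<^sup>2)\<close> uniformly.
  Replacing \<open>h\<close> by \<open>H\<close> inside the last square keeps the constant independent of \<open>h\<close>.
\<close>

lemma set_integral_square_expansion:
  fixes w \<phi> :: "real \<times> real \<Rightarrow> real"
  assumes "x0 > 0" "y0 > 0"
    and [measurable]: "w \<in> borel_measurable borel" "\<phi> \<in> borel_measurable borel"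
      "v \<in> borel_measurable borel"
    and W: "\<And>p. p \<in> Omega x0 y0 \<Longrightarrow> \<bar>w p\<bar> \<le> W" and P: "\<And>p. p \<in> Omega x0 y0 \<Longrightarrow> \<bar>\<phi> p\<bar> \<le> P"
    and R: "\<And>p. p \<in> Omega x0 y0 \<Longrightarrow> \<bar>v p - w p - h * \<phi> p\<bar> \<le> R * h\<^sup>2"
    and h: "0 < h" "h \<le> H"
  shows "\<bar>(LINT p:Omega x0 y0|lborel. (v p)\<^sup>2) - (LINT p:Omega x0 y0|lborel. (w p)\<^sup>2)
      - (2 * (LINT p:Omega x0 y0|lborel. w p * \<phi> p)) * h\<bar>
    \<le> (2 * W * R + (P + R * H)\<^sup>2) * (x0 * y0) * h\<^sup>2"
proof -
  let ?S = "Omega x0 y0"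
  let ?K = "(2 * W * R + (P + R * H)\<^sup>2) * h\<^sup>2"
  have pt: "\<bar>(v p)\<^sup>2 - (w p)\<^sup>2 - 2 * h * (w p * \<phi> p)\<bar> \<le> ?K" if p: "p \<in> ?S" for p
  proof -
    define r where "r = v p - w p - h * \<phi> p"
    have r: "\<bar>r\<bar> \<le> R * h\<^sup>2" using R[OF p] by (simp add: r_def)
    have R0: "0 \<le> R"
      using order_trans[OF abs_ge_zero r] h by (simp add: zero_le_mult_iff)
    have "\<bar>w p\<bar> * \<bar>r\<bar> \<le> W * (R * h\<^sup>2)" using W[OF p] r by (intro mult_mono) auto
    moreover have "\<bar>h * \<phi> p + r\<bar> \<le> h * (P + R * H)"
    proof -
      have "\<bar>h * \<phi> p\<bar> \<le> h * P" using P[OF p] h by (simp add: abs_mult)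
      moreover have "R * h\<^sup>2 \<le> h * (R * H)"
        using R0 h mult_left_mono[of h H "R * h"] by (simp add: power2_eq_square mult_ac)
      ultimately show ?thesis using r by (simp add: algebra_simps)
    qed
    then have "(h * \<phi> p + r)\<^sup>2 \<le> (P + R * H)\<^sup>2 * h\<^sup>2"
      using power_mono[OF _ abs_ge_zero, of "h * \<phi> p + r" "h * (P + R * H)" 2]
      by (simp add: power_mult_distrib mult.commute)
    moreover have "(v p)\<^sup>2 - (w p)\<^sup>2 - 2 * h * (w p * \<phi> p) = 2 * (w p * r) + (h * \<phi> p + r)\<^sup>2"
      by (simp add: r_def power2_eq_square algebra_simps)
    ultimately have "\<bar>(v p)\<^sup>2 - (w p)\<^sup>2 - 2 * h * (w p * \<phi> p)\<bar>
        \<le> 2 * (W * (R * h\<^sup>2)) + (P + R * H)\<^sup>2 * h\<^sup>2"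
      using abs_triangle_ineq[of "2 * (w p * r)" "(h * \<phi> p + r)\<^sup>2"] by (simp add: abs_mult)
    then show ?thesis by (simp add: distrib_right mult.assoc)
  qed
  have W2: "\<bar>(w p)\<^sup>2\<bar> \<le> W\<^sup>2" if "p \<in> ?S" for p
    using power_mono[OF W[OF that] abs_ge_zero, of 2] by simp
  have WP: "\<bar>w p * \<phi> p\<bar> \<le> W * P" if "p \<in> ?S" for p
    unfolding abs_mult using W[OF that] P[OF that] by (intro mult_mono) auto
  have int_w: "set_integrable lborel ?S (\<lambda>p. (w p)\<^sup>2)"
    by (rule set_integrable_Omega_bounded[OF _ W2]) auto
  have int_wp: "set_integrable lborel ?S (\<lambda>p. w p * \<phi> p)"
    by (rule set_integrable_Omega_bounded[OF _ WP]) auto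
  have int_d: "set_integrable lborel ?S (\<lambda>p. (v p)\<^sup>2 - (w p)\<^sup>2 - 2 * h * (w p * \<phi> p))"
    by (rule set_integrable_Omega_bounded[OF _ pt]) auto
  have "(LINT p:?S|lborel. (v p)\<^sup>2) = (LINT p:?S|lborel.
      ((v p)\<^sup>2 - (w p)\<^sup>2 - 2 * h * (w p * \<phi> p)) + ((w p)\<^sup>2 + 2 * h * (w p * \<phi> p)))"
    by simp
  also have "\<dots> = (LINT p:?S|lborel. (v p)\<^sup>2 - (w p)\<^sup>2 - 2 * h * (w p * \<phi> p))
      + ((LINT p:?S|lborel. (w p)\<^sup>2) + 2 * h * (LINT p:?S|lborel. w p * \<phi> p))"
    using int_d int_w int_wp by (subst set_integral_add set_integral_mult_right | simp)+
  finally have "(LINT p:?S|lborel. (v p)\<^sup>2) - (LINT p:?S|lborel. (w p)\<^sup>2)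
      - (2 * (LINT p:?S|lborel. w p * \<phi> p)) * h
      = (LINT p:?S|lborel. (v p)\<^sup>2 - (w p)\<^sup>2 - 2 * h * (w p * \<phi> p))"
    by simp
  also have "\<bar>\<dots>\<bar> \<le> ?K * (x0 * y0)"
    using assms(1,2) by (intro abs_set_integral_Omega_le pt) auto
  finally show ?thesis by (simp add: mult_ac)
qed

section \<open>The discrete optimal control problem\<close>

theorem lemma19:
  fixes x0 y0 g q zd M3 \<alpha> b_op :: real and bh_op :: "nat \<Rightarrow> real"
  assumes "x0 > 0" "y0 > 0" "M3 > 0" "\<alpha> > 0"
    and "is_arg_min (J3 x0 y0 g q zd M3 \<alpha>) (\<lambda>_. True) b_op"
    and "\<And>n. n \<ge> 1 \<Longrightarrow> is_arg_min (J3h x0 y0 g q zd M3 \<alpha> n) (\<lambda>_. True) (bh_op n)"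
  shows
    "(\<forall>n\<ge>1. let h = mesh x0 n; E1 = 1 / (4 * (1 + M3 / x0)) in
        bh_op n = b_op + E1 * g * x0 * h * (1 + 4 / (\<alpha> * x0) + h / (3 * x0))) \<and>
     (\<exists>C13 C14 :: real.
        (\<lambda>n. \<bar>bh_op n - b_op\<bar> - C13 * mesh x0 n) \<in> o[at_top](mesh x0) \<and>
        (\<lambda>n. \<bar>J3h x0 y0 g q zd M3 \<alpha> n (bh_op n) - J3 x0 y0 g q zd M3 \<alpha> b_op\<bar> - C14 * mesh x0 n)
          \<in> o[at_top](mesh x0))"
proof -
  let ?S = "Omega x0 y0"
  have [measurable]: "(fst :: real \<times> real \<Rightarrow> real) \<in> borel_measurable borel"
    by (intro borel_measurable_continuous_onI continuous_intros)
  define w where "w p = u_state x0 g q \<alpha> 0 p - zd" for p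
  define v where "v n p = uh_state x0 g q \<alpha> n 0 p - zd" for n p
  define \<phi> :: "real \<times> real \<Rightarrow> real" where "\<phi> p = - g * (1 / \<alpha> + fst p / 2)" for p
  define P where "P = \<bar>g\<bar> * (1 / \<alpha> + x0 / 2)"
  have meas_w [measurable]: "w \<in> borel_measurable borel"
    unfolding w_def u_state_def case_prod_beta by measurable
  have meas_v [measurable]: "v n \<in> borel_measurable borel" for n
    unfolding v_def uh_state_def case_prod_beta Let_def cell_def by measurable
  have meas_\<phi> [measurable]: "\<phi> \<in> borel_measurable borel"
    unfolding \<phi>_def by measurable
  have P: "\<bar>\<phi> p\<bar> \<le> P" if "p \<in> ?S" for p
    using that \<open>\<alpha> > 0\<close> unfolding \<phi>_def P_def abs_mult
    by (intro mult_mono) (auto simp: Omega_def)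
  obtain W where W: "\<bar>w p\<bar> \<le> W" if "p \<in> ?S" for p
  proof -
    have "continuous_on (cbox (0, 0) (x0, y0)) w"
      unfolding w_def u_state_def case_prod_beta by (intro continuous_intros)
    then obtain W where "norm (w p) \<le> W" if "p \<in> cbox (0, 0) (x0, y0)" for p
      using continuous_on_compact_bound[OF compact_cbox] by metis
    moreover have "?S \<subseteq> cbox (0, 0) (x0, y0)"
      by (auto simp: Omega_def cbox_def Basis_prod_def)
    ultimately show ?thesis by (intro that[of W]) auto
  qed
  have R: "\<bar>v n p - w p - mesh x0 n * \<phi> p\<bar> \<le> \<bar>g\<bar> * (mesh x0 n)\<^sup>2"
    if "n \<ge> 1" "p \<in> ?S" for n p
    using consistency_error[OF \<open>x0 > 0\<close> \<open>n \<ge> 1\<close>, of "fst p" g q \<alpha> 0 "snd p"] that(2)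
    by (auto simp: v_def w_def \<phi>_def Omega_def algebra_simps)
  \<comment> \<open>The discrete states inherit the bound from the exact one, with \<open>h \<le> x0\<close>.\<close>
  have V: "\<bar>v n p\<bar> \<le> W + x0 * P + \<bar>g\<bar> * x0\<^sup>2" if "n \<ge> 1" "p \<in> ?S" for n p
  proof -
    note h = mesh_bounds[OF \<open>x0 > 0\<close> \<open>n \<ge> 1\<close>]
    have "\<bar>mesh x0 n * \<phi> p\<bar> \<le> x0 * P"
      unfolding abs_mult using h P[OF that(2)] by (intro mult_mono) auto
    moreover have "\<bar>g\<bar> * (mesh x0 n)\<^sup>2 \<le> \<bar>g\<bar> * x0\<^sup>2"
      using h by (intro mult_left_mono power_mono) auto
    ultimately show ?thesis using R[OF that] W[OF that(2)] by linarith
  qed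

  define c where "c = y0 * (x0 + M3)"
  define I where "I = (LINT p:?S|lborel. w p)"
  define A where "A = (LINT p:?S|lborel. (w p)\<^sup>2)"
  define Ih where "Ih n = (LINT p:?S|lborel. v n p)" for n
  define Ah where "Ah n = (LINT p:?S|lborel. (v n p)\<^sup>2)" for n
  have c: "c > 0" using assms by (simp add: c_def)
  have J: "J3 x0 y0 g q zd M3 \<alpha> b =
      1 / 2 * (norm_H x0 y0 (\<lambda>p. w p + b))\<^sup>2 + M3 / 2 * (norm_B y0 (\<lambda>_. b))\<^sup>2" for b
    by (simp add: J3_def w_def u_state_def case_prod_beta algebra_simps)
  have Jh: "J3h x0 y0 g q zd M3 \<alpha> n b =
      1 / 2 * (norm_H x0 y0 (\<lambda>p. v n p + b))\<^sup>2 + M3 / 2 * (norm_B y0 (\<lambda>_. b))\<^sup>2" for n b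
    by (simp add: J3h_def v_def uh_state_def Let_def case_prod_beta algebra_simps)
  have min: "b_op = - I / c" "J3 x0 y0 g q zd M3 \<alpha> b_op = A / 2 - I\<^sup>2 / (2 * c)"
    unfolding I_def A_def c_def
    by (rule quadratic_cost_minimum[OF assms(1-3) meas_w W J assms(5)], assumption)+
  have minh: "bh_op n = - Ih n / c"
      "J3h x0 y0 g q zd M3 \<alpha> n (bh_op n) = Ah n / 2 - (Ih n)\<^sup>2 / (2 * c)" if n: "n \<ge> 1" for n
    unfolding Ih_def Ah_def c_def
    by (rule quadratic_cost_minimum[OF assms(1-3) meas_v V[OF n] Jh assms(6)[OF n]], assumption)+

  \<comment> \<open>The coefficients of \<open>h\<close> and \<open>h\<^sup>2\<close> in \<open>y0\<close> times the integral of the state difference over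
    \<open>[0, x0]\<close>.\<close>
  define a1 where "a1 = - y0 * g * x0 * (1 / \<alpha> + x0 / 4)"
  define a2 where "a2 = - y0 * g * x0 / 12"
  have Ih: "Ih n = I + a1 * mesh x0 n + a2 * (mesh x0 n)\<^sup>2" if n: "n \<ge> 1" for n
  proof -
    define d where "d x = uh_state x0 g q \<alpha> n 0 (x, 0) - u_state x0 g q \<alpha> 0 (x, 0)" for x
    have vw: "v n p - w p = d (fst p)" for p
      by (simp add: v_def w_def d_def uh_state_def u_state_def case_prod_beta)
    have "set_integrable lborel ?S (v n)" "set_integrable lborel ?S w"
      by (rule set_integrable_Omega_bounded[OF meas_v V[OF n]], assumption,
          rule set_integrable_Omega_bounded[OF meas_w W])
    then have "Ih n - I = (LINT p:?S|lborel. v n p - w p)"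
      unfolding Ih_def I_def by (simp add: set_integral_diff)
    also have "\<dots> = y0 * integral {0..x0} d"
      unfolding vw
    proof (rule set_integral_Omega_fst)
      show "d \<in> borel_measurable borel"
        unfolding d_def uh_state_def u_state_def case_prod_conv Let_def cell_def by measurable
      show "\<bar>d x\<bar> \<le> (W + x0 * P + \<bar>g\<bar> * x0\<^sup>2) + W" if "x \<in> {0<..<x0}" for x
      proof -
        \<comment> \<open>Any interior ordinate transfers the bounds on the rectangle to \<open>d\<close>.\<close>
        have "(x, y0 / 2) \<in> ?S" using that assms by (simp add: Omega_def)
        from V[OF n this] W[OF this] vw[of "(x, y0 / 2)"] show ?thesis by simp
      qed
    qed (use assms in auto)
    also have "integral {0..x0} d = - (mesh x0 n * g * (x0 / \<alpha> + x0\<^sup>2 / 4)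
        + g * (mesh x0 n)\<^sup>2 / 12 * x0)"
    proof -
      have "real n * mesh x0 n = x0" using n by (simp add: mesh_def)
      with has_integral_state_difference[OF \<open>x0 > 0\<close> order_refl[of n],
          where g = g and q = q and \<alpha> = \<alpha> and b = 0 and y = 0]
      show ?thesis unfolding d_def by (simp add: integral_unique)
    qed
    also have "y0 * \<dots> = a1 * mesh x0 n + a2 * (mesh x0 n)\<^sup>2"
      by (simp add: a1_def a2_def algebra_simps power2_eq_square)
    finally show ?thesis by simp
  qed
  have diff: "bh_op n - b_op = (- a1 / c) * mesh x0 n + (- a2 / c) * (mesh x0 n)\<^sup>2"
    if "n \<ge> 1" for n
    unfolding minh(1)[OF that] min(1) Ih[OF that] by (simp add: diff_divide_distrib add_divide_distrib)

  have formula: "\<forall>n\<ge>1. let h = mesh x0 n; E1 = 1 / (4 * (1 + M3 / x0)) in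
      bh_op n = b_op + E1 * g * x0 * h * (1 + 4 / (\<alpha> * x0) + h / (3 * x0))"
  proof (intro allI impI)
    fix n :: nat assume n: "n \<ge> 1"
    have E: "1 / (4 * (1 + M3 / x0)) = x0 * y0 / (4 * c)"
    proof -
      have "1 + M3 / x0 = c / (x0 * y0)" using assms by (simp add: c_def field_simps)
      then show ?thesis by simp
    qed
    have expand: "(- a1 / c) * h + (- a2 / c) * h\<^sup>2
        = x0 * y0 / (4 * c) * g * x0 * h * (1 + 4 / (\<alpha> * x0) + h / (3 * x0))" for h
      using assms c unfolding a1_def a2_def by (simp add: field_simps power2_eq_square)
    have "bh_op n = b_op + x0 * y0 / (4 * c) * g * x0 * mesh x0 n
        * (1 + 4 / (\<alpha> * x0) + mesh x0 n / (3 * x0))"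
      using diff[OF n] unfolding expand by linarith
    then show "let h = mesh x0 n; E1 = 1 / (4 * (1 + M3 / x0)) in
        bh_op n = b_op + E1 * g * x0 * h * (1 + 4 / (\<alpha> * x0) + h / (3 * x0))"
      unfolding Let_def E .
  qed

  have bound13: "\<bar>(bh_op n - b_op) - (- a1 / c) * mesh x0 n\<bar> \<le> \<bar>a2 / c\<bar> * (mesh x0 n)\<^sup>2"
    if "n \<ge> 1" for n
    unfolding diff[OF that] by (simp add: abs_mult)

  define B where "B = 2 * (LINT p:?S|lborel. w p * \<phi> p)"
  define KA where "KA = (2 * W * \<bar>g\<bar> + (P + \<bar>g\<bar> * x0)\<^sup>2) * (x0 * y0)"
  \<comment> \<open>\<open>I\<^sub>h\<^sup>2 - I\<^sup>2 - 2 * I * a1 * h = ((a1 + a2 * h)\<^sup>2 + 2 * I * a2) * h\<^sup>2\<close>; the bracket is bounded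
    for \<open>h \<le> x0\<close>.\<close>
  define KI where "KI = (\<bar>a1\<bar> + \<bar>a2\<bar> * x0)\<^sup>2 + 2 * \<bar>I\<bar> * \<bar>a2\<bar>"
  have Ah: "\<bar>Ah n - A - B * mesh x0 n\<bar> \<le> KA * (mesh x0 n)\<^sup>2" if n: "n \<ge> 1" for n
    unfolding Ah_def A_def B_def KA_def
    by (rule set_integral_square_expansion[OF assms(1,2) meas_w meas_\<phi> meas_v W P R[OF n]
          mesh_bounds[OF assms(1) n]])
  have Ih2: "\<bar>(Ih n)\<^sup>2 - I\<^sup>2 - 2 * I * a1 * mesh x0 n\<bar> \<le> KI * (mesh x0 n)\<^sup>2" if n: "n \<ge> 1" for n
  proof -
    let ?h = "mesh x0 n"
    note h = mesh_bounds[OF \<open>x0 > 0\<close> n]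
    have "\<bar>a2 * ?h\<bar> \<le> \<bar>a2\<bar> * x0"
      unfolding abs_mult using h by (intro mult_left_mono) auto
    then have "\<bar>a1 + a2 * ?h\<bar> \<le> \<bar>a1\<bar> + \<bar>a2\<bar> * x0" by linarith
    then have "\<bar>a1 + a2 * ?h\<bar>\<^sup>2 \<le> (\<bar>a1\<bar> + \<bar>a2\<bar> * x0)\<^sup>2" by (intro power_mono) auto
    moreover have "\<bar>2 * I * a2\<bar> = 2 * \<bar>I\<bar> * \<bar>a2\<bar>" by (simp add: abs_mult)
    ultimately have "\<bar>(a1 + a2 * ?h)\<^sup>2 + 2 * I * a2\<bar> \<le> KI"
      using abs_triangle_ineq[of "(a1 + a2 * ?h)\<^sup>2" "2 * I * a2"] by (simp add: KI_def)
    then have "\<bar>(a1 + a2 * ?h)\<^sup>2 + 2 * I * a2\<bar> * ?h\<^sup>2 \<le> KI * ?h\<^sup>2"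
      by (intro mult_right_mono) auto
    moreover have "(Ih n)\<^sup>2 - I\<^sup>2 - 2 * I * a1 * ?h = ((a1 + a2 * ?h)\<^sup>2 + 2 * I * a2) * ?h\<^sup>2"
      unfolding Ih[OF n] by (simp add: power2_eq_square algebra_simps)
    ultimately show ?thesis by (simp add: abs_mult)
  qed
  have bound14: "\<bar>(J3h x0 y0 g q zd M3 \<alpha> n (bh_op n) - J3 x0 y0 g q zd M3 \<alpha> b_op)
      - (B / 2 - I * a1 / c) * mesh x0 n\<bar> \<le> (KA / 2 + KI / (2 * c)) * (mesh x0 n)\<^sup>2"
    if n: "n \<ge> 1" for n
  proof -
    let ?h = "mesh x0 n"
    have "(J3h x0 y0 g q zd M3 \<alpha> n (bh_op n) - J3 x0 y0 g q zd M3 \<alpha> b_op) - (B / 2 - I * a1 / c) * ?h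
        = (Ah n - A - B * ?h) / 2 - ((Ih n)\<^sup>2 - I\<^sup>2 - 2 * I * a1 * ?h) / (2 * c)"
      unfolding minh(2)[OF n] min(2) using c by (simp add: field_simps)
    moreover have "\<bar>(Ah n - A - B * ?h) / 2\<bar> \<le> KA / 2 * ?h\<^sup>2" using Ah[OF n] by simp
    moreover have "\<bar>((Ih n)\<^sup>2 - I\<^sup>2 - 2 * I * a1 * ?h) / (2 * c)\<bar> \<le> KI / (2 * c) * ?h\<^sup>2"
      using Ih2[OF n] c by (simp add: divide_right_mono)
    ultimately show ?thesis unfolding distrib_right by linarith
  qed
  show ?thesis
    using formula abs_first_order_smallo[OF bound13 \<open>x0 > 0\<close>]
      abs_first_order_smallo[OF bound14 \<open>x0 > 0\<close>] by blast
qed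

end
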